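(* For all integers $j \geq 0$ and $k \geq 2$, there is some $N$ such that for all $n \geq N$ we have \[FD_{j,k}(n) \geq FO_{j,k}(n).\]
   Context: An integer partition is a weakly decreasing finite sequence $\mu = (\mu_1, \ldots, \mu_m)$ of positive integers (its parts); $\ell(\mu) := m$ is its length. The perimeter of a nonempty partition $\mu$ is $P(\mu) := \mu_1 + \ell(\mu) - 1$. $FD_{j,k}(n)$ is the number of partitions with perimeter $n$ having exactly $j$ distinct part sizes that appear at least $k$ times. $FO_{j,k}(n)$ is the number of partitions with perimeter $n$ having exactly $j$ distinct part sizes that are divisible by $k$. *)

theory Defs
  imports Main
begin

definition is_partition :: "nat list \<Rightarrow> bool" where
  "is_partition \<mu> \<longleftrightarrow> sorted_wrt (\<ge>) \<mu> \<and> (\<forall>p\<in>set \<mu>. p > 0)"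

(* The largest part is the head of the list; only meaningful for nonempty lists. *)
definition perimeter :: "nat list \<Rightarrow> nat" where
  "perimeter \<mu> = hd \<mu> + length \<mu> - 1"

definition perimeter_partitions :: "nat \<Rightarrow> nat list set" where
  "perimeter_partitions n = {\<mu>. is_partition \<mu> \<and> \<mu> \<noteq> [] \<and> perimeter \<mu> = n}"

definition FD :: "nat \<Rightarrow> nat \<Rightarrow> nat \<Rightarrow> nat" where
  "FD j k n = card {\<mu> \<in> perimeter_partitions n. card {p \<in> set \<mu>. count_list \<mu> p \<ge> k} = j}"

definition FO :: "nat \<Rightarrow> nat \<Rightarrow> nat \<Rightarrow> nat" where
  "FO j k n = card {\<mu> \<in> perimeter_partitions n. card {p \<in> set \<mu>. k dvd p} = j}"

(* Hence the cardinalities in FD and FO are those of finite sets. *)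
lemma finite_perimeter_partitions: "finite (perimeter_partitions n)"
proof (rule finite_subset)
  show "perimeter_partitions n \<subseteq> {\<mu>. set \<mu> \<subseteq> {..n} \<and> length \<mu> \<le> n}"
  proof
    fix \<mu> assume a: "\<mu> \<in> perimeter_partitions n"
    then obtain x xs where \<mu>: "\<mu> = x # xs"
      by (cases \<mu>) (auto simp: perimeter_partitions_def)
    with a show "\<mu> \<in> {\<mu>. set \<mu> \<subseteq> {..n} \<and> length \<mu> \<le> n}"
      by (auto simp: perimeter_partitions_def perimeter_def is_partition_def)
  qed
  show "finite {\<mu>. set \<mu> \<subseteq> {..n} \<and> length \<mu> \<le> n}"
    by (rule finite_lists_length_le) simp
qed

end

theory Submission
  imports Defs Complex_Main
begin

text \<open>
  Read the boundary of the Young diagram as a word: starting from the part size 1, each step either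
  raises the current size by one or emits a part of the current size, and a final part is emitted
  at the end. Partitions of perimeter \<open>n\<close> correspond to words of length \<open>n - 1\<close>, and both statistics
  are computed by finite automata reading the word. For \<open>k = 2\<close> the two automata are isomorphic, with
  the two letters swapped in one state, so the counts agree. For \<open>k \<ge> 3\<close> potential functions on the states show that
  \<open>FO\<close> is \<open>O((1 + t)^n)\<close> whenever \<open>(1 + t) t^(k-1) > 1\<close>, while \<open>FD\<close> is at least a positive multiple of
  \<open>(1 + s)^n\<close> whenever \<open>(1 - s) (1 + s)^k \<ge> 1\<close>. The choice \<open>t = 1 - 1/(2k-1) < s = 1 - 1/(2k)\<close>
  satisfies both conditions.
\<close>

section \<open>Partitions with parts at least \<open>c\<close>, and the recursion along boundary
  words\<close>

text \<open>The state of a word with current size \<open>c\<close> and \<open>m\<close> letters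
  still to read: \<open>hd xs - c\<close> raises and \<open>length xs - 1\<close> emissions before
  the final part, so \<open>m = (hd xs - c) + (length xs - 1)\<close>.\<close>

definition parts_from :: "nat \<Rightarrow> nat \<Rightarrow> nat list set" where
  "parts_from c m = {xs. sorted_wrt (\<ge>) xs \<and> (\<forall>p\<in>set xs. c \<le> p) \<and> xs \<noteq> [] \<and>
     hd xs + length xs = c + m + 1}"

lemma perimeter_partitions_eq_parts_from:
  "perimeter_partitions (Suc m) = parts_from 1 m"
proof -
  have "perimeter xs = Suc m \<longleftrightarrow> hd xs + length xs = 1 + m + 1" for xs
    by (auto simp: perimeter_def)
  then show ?thesis
    unfolding perimeter_partitions_def parts_from_def is_partition_def
    by (auto simp: Suc_le_eq)
qed

lemma parts_from_0: "parts_from c 0 = {[c]}"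
proof (rule set_eqI)
  fix xs show "xs \<in> parts_from c 0 \<longleftrightarrow> xs \<in> {[c]}"
    by (cases xs) (auto simp: parts_from_def)
qed

text \<open>Case split on the first letter. The smallest part stands last in the list: it exceeds
  \<open>c\<close> after a raise, and equals \<open>c\<close> after an emission.\<close>

lemma parts_from_Suc:
  "parts_from c (Suc m) = parts_from (Suc c) m \<union> (\<lambda>xs. xs @ [c]) ` parts_from c m"
proof (intro equalityI subsetI)
  fix xs assume xs: "xs \<in> parts_from c (Suc m)"
  then obtain ys a where ya: "xs = ys @ [a]"
    by (cases xs rule: rev_cases) (auto simp: parts_from_def)
  show "xs \<in> parts_from (Suc c) m \<union> (\<lambda>xs. xs @ [c]) ` parts_from c m"
  proof (cases "a = c")
    case True
    with xs ya have "ys \<in> parts_from c m"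
      by (cases ys) (auto simp: parts_from_def sorted_wrt_append)
    then show ?thesis using True ya by blast
  next
    case False
    with xs ya have "\<forall>p\<in>set xs. Suc c \<le> p"
      by (fastforce simp: parts_from_def sorted_wrt_append)
    with xs show ?thesis by (auto simp: parts_from_def)
  qed
next
  fix xs assume "xs \<in> parts_from (Suc c) m \<union> (\<lambda>xs. xs @ [c]) ` parts_from c m"
  then show "xs \<in> parts_from c (Suc m)"
    by (auto simp: parts_from_def sorted_wrt_append Suc_le_eq)
qed

lemma finite_parts_from: "finite (parts_from c m)"
  by (induction m arbitrary: c) (auto simp: parts_from_0 parts_from_Suc)

lemma card_filter_parts_from_Suc:
  "card {xs \<in> parts_from c (Suc m). P xs} =
     card {xs \<in> parts_from (Suc c) m. P xs} + card {xs \<in> parts_from c m. P (xs @ [c])}"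
proof -
  have eq: "{xs \<in> parts_from c (Suc m). P xs} =
      {xs \<in> parts_from (Suc c) m. P xs} \<union> (\<lambda>xs. xs @ [c]) ` {xs \<in> parts_from c m. P (xs @ [c])}"
    by (auto simp: parts_from_Suc)
  have disj: "{xs \<in> parts_from (Suc c) m. P xs} \<inter>
      (\<lambda>xs. xs @ [c]) ` {xs \<in> parts_from c m. P (xs @ [c])} = {}"
    by (auto simp: parts_from_def)
  show ?thesis
    unfolding eq
    by (subst card_Un_disjoint[OF _ _ disj])
       (auto simp: finite_parts_from card_image inj_on_def)
qed

section \<open>The automaton for parts divisible by \<open>k\<close>\<close>

text \<open>In the automaton for \<open>FO\<close>, the flag \<open>e\<close> records that a part of the current size \<open>c\<close> has
  already been emitted; \<open>dvd_stat\<close> counts what the remaining word contributes.\<close>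

definition dvd_stat :: "nat \<Rightarrow> nat \<Rightarrow> bool \<Rightarrow> nat list \<Rightarrow> nat" where
  "dvd_stat k c e xs = card {p \<in> set xs. k dvd p \<and> (e \<longrightarrow> p \<noteq> c)}"

definition dvd_count :: "nat \<Rightarrow> nat \<Rightarrow> bool \<Rightarrow> nat \<Rightarrow> nat \<Rightarrow> nat" where
  "dvd_count k c e m j = card {xs \<in> parts_from c m. dvd_stat k c e xs = j}"

lemma FO_eq_dvd_count: "FO j k (Suc m) = dvd_count k 1 False m j"
  by (simp add: FO_def dvd_count_def dvd_stat_def perimeter_partitions_eq_parts_from)

text \<open>After a raise the size \<open>c\<close> cannot occur again, so the flag carries no
  information and is reset.\<close>

lemma dvd_stat_raise:
  assumes "xs \<in> parts_from (Suc c) m"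
  shows "dvd_stat k c e xs = dvd_stat k (Suc c) False xs"
proof -
  have "{p \<in> set xs. k dvd p \<and> (e \<longrightarrow> p \<noteq> c)} = {p \<in> set xs. k dvd p}"
    using assms by (auto simp: parts_from_def)
  then show ?thesis by (simp add: dvd_stat_def)
qed

lemma dvd_stat_emit:
  "dvd_stat k c e (xs @ [c]) =
     (if k dvd c \<and> \<not> e then Suc (dvd_stat k c True xs) else dvd_stat k c e xs)"
proof -
  have "{p \<in> set (xs @ [c]). k dvd p \<and> (e \<longrightarrow> p \<noteq> c)} =
      (if k dvd c \<and> \<not> e then insert c {p \<in> set xs. k dvd p \<and> p \<noteq> c}
       else {p \<in> set xs. k dvd p \<and> (e \<longrightarrow> p \<noteq> c)})"
    by auto
  then show ?thesis by (simp add: dvd_stat_def)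
qed

lemma dvd_count_0:
  "dvd_count k c e 0 j = (if j = (if k dvd c \<and> \<not> e then 1 else 0) then 1 else 0)"
proof -
  have "dvd_stat k c e [c] = (if k dvd c \<and> \<not> e then 1 else 0)"
    using dvd_stat_emit[of k c e "[]"] by (simp add: dvd_stat_def)
  then have "{xs \<in> parts_from c 0. dvd_stat k c e xs = j} =
      (if j = (if k dvd c \<and> \<not> e then 1 else 0) then {[c]} else {})"
    by (auto simp: parts_from_0)
  then show ?thesis by (simp add: dvd_count_def)
qed

lemma dvd_count_Suc:
  "dvd_count k c e (Suc m) j = dvd_count k (Suc c) False m j +
     (if k dvd c \<and> \<not> e then (case j of 0 \<Rightarrow> 0 | Suc i \<Rightarrow> dvd_count k c True m i)
      else dvd_count k c e m j)"
proof -
  have "{xs \<in> parts_from (Suc c) m. dvd_stat k c e xs = j} =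
      {xs \<in> parts_from (Suc c) m. dvd_stat k (Suc c) False xs = j}"
    using dvd_stat_raise by auto
  then show ?thesis
    unfolding dvd_count_def card_filter_parts_from_Suc
    by (cases j; cases "k dvd c"; cases e) (simp_all add: dvd_stat_emit)
qed

section \<open>The automaton for parts repeated at least \<open>k\<close> times\<close>

text \<open>In the automaton for \<open>FD\<close>, \<open>r\<close> is the number of parts of the current size \<open>c\<close> emitted so far,
  capped at \<open>k\<close>.\<close>

definition rep_stat :: "nat \<Rightarrow> nat \<Rightarrow> nat \<Rightarrow> nat list \<Rightarrow> nat" where
  "rep_stat k c r xs =
     card {p \<in> set xs. if p = c then r < k \<and> k \<le> count_list xs p + r else k \<le> count_list xs p}"

definition rep_count :: "nat \<Rightarrow> nat \<Rightarrow> nat \<Rightarrow> nat \<Rightarrow> nat \<Rightarrow> nat" where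
  "rep_count k c r m j = card {xs \<in> parts_from c m. rep_stat k c r xs = j}"

lemma rep_stat_0: "0 < k \<Longrightarrow> rep_stat k c 0 xs = card {p \<in> set xs. count_list xs p \<ge> k}"
  unfolding rep_stat_def by (rule arg_cong[where f = card]) auto

lemma FD_eq_rep_count:
  assumes "0 < k"
  shows "FD j k (Suc m) = rep_count k 1 0 m j"
  using assms by (simp add: FD_def rep_count_def rep_stat_0 perimeter_partitions_eq_parts_from)

lemma rep_stat_raise:
  assumes "xs \<in> parts_from (Suc c) m" "0 < k"
  shows "rep_stat k c r xs = rep_stat k (Suc c) 0 xs"
proof -
  have "c \<notin> set xs" using assms by (auto simp: parts_from_def)
  then have "{p \<in> set xs. if p = c then r < k \<and> k \<le> count_list xs p + r else k \<le> count_list xs p}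
      = {p \<in> set xs. count_list xs p \<ge> k}"
    by auto
  then show ?thesis unfolding rep_stat_0[OF assms(2)] by (simp add: rep_stat_def)
qed

lemma rep_stat_emit:
  assumes "r \<le> k"
  shows "rep_stat k c r (xs @ [c]) =
     (if Suc r < k then rep_stat k c (Suc r) xs
      else if Suc r = k then Suc (rep_stat k c k xs) else rep_stat k c r xs)"
proof -
  let ?S = "\<lambda>r xs. {p \<in> set xs. if p = c then r < k \<and> k \<le> count_list xs p + r
    else k \<le> count_list xs p}"
  consider "Suc r < k" | "Suc r = k" | "r = k" using assms by linarith
  then show ?thesis
  proof cases
    case 1
    then have "?S r (xs @ [c]) = ?S (Suc r) xs"
      by (cases "c \<in> set xs") auto
    with 1 show ?thesis by (simp add: rep_stat_def)
  next
    case 2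
    then have S: "?S r (xs @ [c]) = insert c (?S k xs)" by auto
    \<comment> \<open>State \<open>k\<close> masks the size \<open>c\<close>, so the inserted
      element is new even if \<open>c\<close> occurs in \<open>xs\<close>.\<close>
    have "card (?S r (xs @ [c])) = Suc (card (?S k xs))"
      unfolding S by (rule card_insert_disjoint) simp_all
    with 2 show ?thesis by (simp add: rep_stat_def)
  next
    case 3
    then have "?S r (xs @ [c]) = ?S r xs" by auto
    with 3 show ?thesis by (simp add: rep_stat_def)
  qed
qed

lemma rep_count_0:
  assumes "r \<le> k"
  shows "rep_count k c r 0 j = (if j = (if Suc r = k then 1 else 0) then 1 else 0)"
proof -
  have "rep_stat k c r [c] = (if Suc r = k then 1 else 0)"
    using rep_stat_emit[OF assms, of c "[]"] by (simp add: rep_stat_def)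
  then have "{xs \<in> parts_from c 0. rep_stat k c r xs = j} =
      (if j = (if Suc r = k then 1 else 0) then {[c]} else {})"
    by (auto simp: parts_from_0)
  then show ?thesis by (simp add: rep_count_def)
qed

lemma rep_count_Suc:
  assumes "r \<le> k" "0 < k"
  shows "rep_count k c r (Suc m) j = rep_count k (Suc c) 0 m j +
     (if Suc r < k then rep_count k c (Suc r) m j
      else if Suc r = k then (case j of 0 \<Rightarrow> 0 | Suc i \<Rightarrow> rep_count k c k m i)
      else rep_count k c r m j)"
proof -
  have "{xs \<in> parts_from (Suc c) m. rep_stat k c r xs = j} =
      {xs \<in> parts_from (Suc c) m. rep_stat k (Suc c) 0 xs = j}"
    using rep_stat_raise[OF _ assms(2)] by auto
  then show ?thesis
    unfolding rep_count_def card_filter_parts_from_Suc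
    by (cases j) (simp_all add: rep_stat_emit[OF assms(1)])
qed

section \<open>The case \<open>k = 2\<close>: equality of the two counts\<close>

text \<open>Odd sizes correspond to \<open>r = 0\<close>, fresh even sizes to \<open>r = 1\<close>,
  emitted even sizes to \<open>r = 2\<close>. Only in the first state are the letters swapped: a
  raise from an odd size matches an emission from \<open>r = 0\<close>. The size \<open>d\<close> is
  arbitrary because repetition does not depend on the actual size.\<close>

lemma dvd_count_2_eq_rep_count_2:
  "dvd_count 2 c e m j = rep_count 2 d (if odd c then 0 else if e then 2 else 1) m j"
proof (induction m arbitrary: c e j d)
  case 0
  show ?case by (auto simp: dvd_count_0 rep_count_0)
next
  case (Suc m)
  show ?case
  proof (cases "odd c")
    case True
    then show ?thesis
      using Suc.IH[of "Suc c" False j d] Suc.IH[of c e j "Suc d"]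
      by (simp add: dvd_count_Suc rep_count_Suc)
  next
    case False
    then show ?thesis
      using Suc.IH[of "Suc c" False j "Suc d"] Suc.IH[of c True _ d]
      by (auto simp: dvd_count_Suc rep_count_Suc split: nat.split)
  qed
qed

lemma FD_2_eq_FO_2: "FD j 2 (Suc m) = FO j 2 (Suc m)"
  using dvd_count_2_eq_rep_count_2[of 1 False m j 1]
  by (simp add: FO_eq_dvd_count FD_eq_rep_count)

section \<open>Exponential upper bound for \<open>FO\<close>\<close>

text \<open>A positive eigenvector of the transfer operator for the eigenvalue \<open>1 + t\<close>,
  when each newly counted size has weight \<open>y = (1 + t) * t ^ k - t\<close>. The exponent is
  the number of raises to the next multiple of \<open>k\<close>; each raise multiplies by
  \<open>t\<close>, except out of a fresh multiple, which has value 1.\<close>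

definition dvd_potential :: "nat \<Rightarrow> real \<Rightarrow> nat \<Rightarrow> bool \<Rightarrow> real" where
  "dvd_potential k t c e =
     (if k dvd c then (if e then 1 / t ^ k else 1) else 1 / t ^ (k - c mod k))"

lemma dvd_potential_ge_1:
  assumes "0 < t" "t < 1"
  shows "1 \<le> dvd_potential k t c e"
  using assms by (simp add: dvd_potential_def power_le_one)

lemma dvd_potential_raise_nondvd:
  assumes "0 < t" "2 \<le> k" "\<not> k dvd c"
  shows "dvd_potential k t (Suc c) False = t * dvd_potential k t c e"
proof -
  have lt: "c mod k < k" using assms by simp
  have pos: "c mod k \<noteq> 0" using assms by (simp add: dvd_eq_mod_eq_0)
  show ?thesis
  proof (cases "Suc (c mod k) = k")
    case True
    then have "k dvd Suc c" by (simp add: dvd_eq_mod_eq_0 mod_Suc)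
    moreover have "k - c mod k = 1" using True by linarith
    ultimately show ?thesis using assms by (simp add: dvd_potential_def)
  next
    case False
    then have m: "Suc c mod k = Suc (c mod k)" by (simp add: mod_Suc)
    then have "\<not> k dvd Suc c" by (simp add: dvd_eq_mod_eq_0)
    moreover have "k - c mod k = Suc (k - Suc c mod k)" using m lt False by linarith
    ultimately show ?thesis using assms by (simp add: dvd_potential_def)
  qed
qed

lemma dvd_potential_raise_dvd:
  assumes "0 < t" "2 \<le> k" "k dvd c"
  shows "dvd_potential k t (Suc c) False = t / t ^ k"
proof -
  have m: "Suc c mod k = 1" using assms by (simp add: dvd_eq_mod_eq_0 mod_Suc)
  then have "\<not> k dvd Suc c" by (simp add: dvd_eq_mod_eq_0)
  moreover have "t ^ k = t * t ^ (k - 1)" using assms by (cases k) auto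
  ultimately show ?thesis using assms m by (simp add: dvd_potential_def)
qed

text \<open>The weight \<open>y\<close> is chosen such that every state satisfies its potential equation with
  growth factor \<open>1 + t\<close>.\<close>

lemma dvd_count_upper_bound:
  fixes t :: real
  assumes t: "0 < t" "t < 1" and k: "2 \<le> k"
    and y_def: "y = (1 + t) * t ^ k - t" and y: "0 < y"
  shows "y ^ j * real (dvd_count k c e m j) \<le> dvd_potential k t c e * (1 + t) ^ m"
proof -
  have "t ^ k \<le> 1" using t by (simp add: power_le_one)
  then have "(1 + t) * t ^ k \<le> (1 + t) * 1" using t by (intro mult_left_mono) auto
  \<comment> \<open>Needed for the empty word at a fresh multiple of \<open>k\<close>, where
    \<open>j = 1\<close> and the left side is \<open>y\<close>.\<close>
  then have y1: "y \<le> 1" using y_def by simp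
  show ?thesis
  proof (induction m arbitrary: c e j)
    case 0
    have "y ^ j * real (dvd_count k c e 0 j) \<le> 1"
      using y y1 by (auto simp: dvd_count_0)
    also have "\<dots> \<le> dvd_potential k t c e" by (rule dvd_potential_ge_1[OF t])
    finally show ?case by simp
  next
    case (Suc m)
    let ?q = "(1 + t) ^ m"
    have q: "0 < ?q" using t by simp
    have up: "y ^ j * real (dvd_count k (Suc c) False m j) \<le> dvd_potential k t (Suc c) False * ?q"
      by (rule Suc.IH)
    consider (nondvd) "\<not> k dvd c" | (old) "k dvd c" e | (new) "k dvd c" "\<not> e" by blast
    then show ?case
    proof cases
      case nondvd
      have "y ^ j * real (dvd_count k c e (Suc m) j)
          = y ^ j * real (dvd_count k (Suc c) False m j) + y ^ j * real (dvd_count k c e m j)"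
        using nondvd by (simp add: dvd_count_Suc algebra_simps)
      also have "\<dots> \<le> dvd_potential k t (Suc c) False * ?q + dvd_potential k t c e * ?q"
        using up Suc.IH by (rule add_mono)
      also have "\<dots> = dvd_potential k t c e * (1 + t) ^ Suc m"
        using dvd_potential_raise_nondvd[OF t(1) k nondvd, of e] by (simp add: algebra_simps)
      finally show ?thesis .
    next
      case old
      have "y ^ j * real (dvd_count k c e (Suc m) j)
          = y ^ j * real (dvd_count k (Suc c) False m j) + y ^ j * real (dvd_count k c e m j)"
        using old by (simp add: dvd_count_Suc algebra_simps)
      also have "\<dots> \<le> dvd_potential k t (Suc c) False * ?q + dvd_potential k t c e * ?q"
        using up Suc.IH by (rule add_mono)
      also have "\<dots> = t / t ^ k * ?q + 1 / t ^ k * ?q"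
        using dvd_potential_raise_dvd[OF t(1) k] old by (simp add: dvd_potential_def)
      also have "\<dots> = dvd_potential k t c e * (1 + t) ^ Suc m"
        using old by (simp add: dvd_potential_def add_divide_distrib distrib_right)
      finally show ?thesis .
    next
      case new
      have emit: "y ^ j * real (case j of 0 \<Rightarrow> 0 | Suc i \<Rightarrow> dvd_count k c True m i)
          \<le> y * (dvd_potential k t c True * ?q)"
      proof (cases j)
        case 0
        have "0 \<le> dvd_potential k t c True" using dvd_potential_ge_1[OF t, of k c True] by simp
        then show ?thesis using 0 y q by simp
      next
        case (Suc i)
        have "y * (y ^ i * real (dvd_count k c True m i)) \<le> y * (dvd_potential k t c True * ?q)"
          using Suc.IH[of i c True] y by (intro mult_left_mono) auto
        then show ?thesis using Suc by (simp add: mult.assoc)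
      qed
      have "y ^ j * real (dvd_count k c e (Suc m) j)
          = y ^ j * real (dvd_count k (Suc c) False m j)
            + y ^ j * real (case j of 0 \<Rightarrow> 0 | Suc i \<Rightarrow> dvd_count k c True m i)"
        using new by (simp add: dvd_count_Suc distrib_left)
      also have "\<dots> \<le> dvd_potential k t (Suc c) False * ?q + y * (dvd_potential k t c True * ?q)"
        using up emit by (rule add_mono)
      also have "\<dots> = (t + y) / t ^ k * ?q"
        using dvd_potential_raise_dvd[OF t(1) k] new
        by (simp add: dvd_potential_def add_divide_distrib distrib_right)
      also have "\<dots> = dvd_potential k t c e * (1 + t) ^ Suc m"
        using new t(1) y_def by (simp add: dvd_potential_def)
      finally show ?thesis .
    qed
  qed
qed

section \<open>Exponential lower bound for \<open>FD\<close>\<close>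

text \<open>The bound starts at \<open>Suc m\<close> since in state \<open>r = k - 1\<close> the final emission completes a run
  of length \<open>k\<close>.\<close>

lemma rep_count_lower_bound_0:
  fixes s :: real
  assumes s: "0 < s" "1 \<le> (1 - s) * (1 + s) ^ k" and k: "2 \<le> k" and r: "r < k"
  shows "(1 - 1 / (1 + s) ^ (k - r)) * (1 + s) ^ m \<le> real (rep_count k c r (Suc m) 0)"
  using r
proof (induction m arbitrary: c r)
  case 0
  \<comment> \<open>Witness: a raise followed by the final part, a run of length 1 <
    \<open>k\<close>.\<close>
  have "rep_count k (Suc c) 0 0 0 = 1" using k by (simp add: rep_count_0)
  then have "1 \<le> rep_count k c r (Suc 0) 0" using 0 k by (simp add: rep_count_Suc)
  moreover have "1 - 1 / (1 + s) ^ (k - r) \<le> 1" using s by simp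
  ultimately have "1 - 1 / (1 + s) ^ (k - r) \<le> real (rep_count k c r (Suc 0) 0)"
    by linarith
  then show ?case by simp
next
  case (Suc m)
  let ?q = "(1 + s) ^ m"
  have q: "0 < ?q" using s by simp
  \<comment> \<open>With \<open>v r = 1 - 1 / (1 + s) ^ (k - r)\<close>, this gives
    \<open>(1 + s) * v r \<le> v 0 + v (Suc r)\<close>, matching the two letters.\<close>
  have "1 / (1 + s) ^ k \<le> 1 - s" using s by (simp add: divide_le_eq)
  then have key: "1 + s \<le> 2 - 1 / (1 + s) ^ k" by simp
  have kr: "k - r = Suc (k - Suc r)" using Suc.prems by simp
  \<comment> \<open>For \<open>Suc r = k\<close> an emission would complete a run, which
    \<open>j = 0\<close> forbids; the potential vanishes there as well.\<close>
  have emit: "(1 - 1 / (1 + s) ^ (k - Suc r)) * ?q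
      \<le> real (if Suc r < k then rep_count k c (Suc r) (Suc m) 0 else 0)"
    using Suc.IH[of "Suc r" c] Suc.prems by (cases "Suc r < k") auto
  have "(1 - 1 / (1 + s) ^ (k - r)) * (1 + s) ^ Suc m
      = (1 + s - 1 / (1 + s) ^ (k - Suc r)) * ?q"
    using s unfolding kr by (simp add: left_diff_distrib)
  also have "\<dots> \<le> (2 - 1 / (1 + s) ^ k - 1 / (1 + s) ^ (k - Suc r)) * ?q"
    using key q by (intro mult_right_mono) auto
  also have "\<dots> = (1 - 1 / (1 + s) ^ (k - 0)) * ?q + (1 - 1 / (1 + s) ^ (k - Suc r)) * ?q"
    by (simp add: algebra_simps)
  also have "\<dots> \<le> real (rep_count k (Suc c) 0 (Suc m) 0)
      + real (if Suc r < k then rep_count k c (Suc r) (Suc m) 0 else 0)"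
    using Suc.IH[of 0 "Suc c"] emit k by (intro add_mono) auto
  also have "\<dots> \<le> real (rep_count k c r (Suc (Suc m)) 0)"
    using Suc.prems k by (subst rep_count_Suc[of r k c "Suc m"]) auto
  finally show ?case .
qed

text \<open>Prefixing \<open>k - r\<close> emissions is injective on words and completes one run of
  size \<open>c\<close>.\<close>

lemma rep_count_complete_run:
  assumes "r < k"
  shows "rep_count k c k m j \<le> rep_count k c r (m + (k - r)) (Suc j)"
  using assms
proof (induction "k - r" arbitrary: r)
  case 0
  then show ?case by simp
next
  case (Suc d)
  have "m + (k - r) = Suc (m + (k - Suc r))" using Suc.prems by simp
  moreover have "rep_count k c k m j \<le> rep_count k c (Suc r) (m + (k - Suc r)) (Suc j)"
    if "Suc r < k" using Suc.hyps that by (intro Suc.hyps) auto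
  ultimately show ?case
    using Suc.prems by (cases "Suc r < k") (auto simp: rep_count_Suc intro: trans_le_add2)
qed

lemma rep_count_add_run:
  assumes "0 < k"
  shows "rep_count k (Suc c) 0 m j \<le> rep_count k c 0 (m + Suc k) (Suc j)"
proof -
  have "rep_count k (Suc c) 0 m j \<le> rep_count k c k (Suc m) j"
    using assms by (simp add: rep_count_Suc)
  also have "\<dots> \<le> rep_count k c 0 (m + Suc k) (Suc j)"
    using rep_count_complete_run[OF assms, of c "Suc m" j] by simp
  finally show ?thesis .
qed

text \<open>Prefixing \<open>j\<close> blocks of \<open>k\<close> emissions and one raise to words
  without repeated sizes of multiplicity \<open>k\<close> gives exactly \<open>j\<close> such sizes.
  The blocks have fixed total length, so the growth rate is kept.\<close>

lemma rep_count_lower_bound: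
  fixes s :: real
  assumes "0 < s" "1 \<le> (1 - s) * (1 + s) ^ k" "2 \<le> k"
  shows "(1 - 1 / (1 + s) ^ k) * (1 + s) ^ m \<le> real (rep_count k c 0 (Suc m + Suc k * j) j)"
proof (induction j arbitrary: c)
  case 0
  show ?case using rep_count_lower_bound_0[OF assms, of 0] assms(3) by simp
next
  case (Suc j)
  have "rep_count k (Suc c) 0 (Suc m + Suc k * j) j
      \<le> rep_count k c 0 (Suc m + Suc k * j + Suc k) (Suc j)"
    using assms(3) by (intro rep_count_add_run) simp
  also have "Suc m + Suc k * j + Suc k = Suc m + Suc k * Suc j" by simp
  finally show ?case using Suc.IH[of "Suc c"] by linarith
qed

section \<open>Choice of the growth rates and asymptotic comparison\<close>

text \<open>This makes the weight \<open>y\<close> of the upper bound positive. With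
  \<open>d = 1 - t\<close>, Bernoulli gives \<open>t ^ (k - 1) \<ge> (1 + d) / 2\<close>, and
  \<open>(2 - d) * (1 + d) = 2 + d - d ^ 2 > 2\<close>.\<close>

lemma upper_growth_rate:
  fixes k :: nat
  assumes "2 \<le> k"
  defines "t \<equiv> 1 - 1 / (2 * real k - 1)"
  shows "t < (1 + t) * t ^ k"
proof -
  define d where "d = 1 / (2 * real k - 1)"
  have k2: "2 \<le> real k" using assms by simp
  have d: "0 < d" "d \<le> 1 / 3" using k2 by (auto simp: d_def field_simps)
  have dk: "real k * d = (1 + d) / 2" using k2 by (simp add: d_def field_simps)
  have "1 + real (k - 1) * (- d) \<le> (1 + (- d)) ^ (k - 1)"
    using d by (intro Bernoulli_inequality) auto
  moreover have "real (k - 1) * (- d) = d - real k * d"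
    using assms by (simp add: of_nat_diff algebra_simps)
  ultimately have b: "(1 + d) / 2 \<le> t ^ (k - 1)" using dk by (simp add: t_def d_def)
  have "2 < (2 - d) * (1 + d)"
    using d by (simp add: algebra_simps)
  then have "1 < (2 - d) * ((1 + d) / 2)" by simp
  also have "\<dots> \<le> (2 - d) * t ^ (k - 1)" using b d by (intro mult_left_mono) auto
  also have "2 - d = 1 + t" by (simp add: t_def d_def)
  finally have "1 < (1 + t) * t ^ (k - 1)" .
  moreover have "0 < t" using d by (simp add: t_def d_def)
  ultimately have "t * 1 < t * ((1 + t) * t ^ (k - 1))" by (intro mult_strict_left_mono)
  moreover have "t ^ k = t * t ^ (k - 1)" using assms by (cases k) auto
  ultimately show ?thesis by (simp add: mult.left_commute)
qed

text \<open>Write \<open>1 + s = 2 * (1 - h)\<close> with \<open>h = 1 / (4 * k)\<close>. Bernoulli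
  gives \<open>(1 - h) ^ k \<ge> 3 / 4\<close>, which reduces the claim to
  \<open>8 * k \<le> 3 * 2 ^ k\<close>.\<close>

lemma lower_growth_rate:
  fixes k :: nat
  assumes "3 \<le> k"
  defines "s \<equiv> 1 - 1 / (2 * real k)"
  shows "1 \<le> (1 - s) * (1 + s) ^ k"
proof -
  define h where "h = 1 / (4 * real k)"
  have k3: "3 \<le> real k" using assms by simp
  have "1 + real k * (- h) \<le> (1 + (- h)) ^ k"
    using k3 by (intro Bernoulli_inequality) (auto simp: h_def field_simps)
  then have b: "3 / 4 \<le> (1 - h) ^ k" using k3 by (simp add: h_def)
  \<comment> \<open>Equality at \<open>k = 3\<close>; false at \<open>k = 2\<close>.\<close>
  have "8 * k \<le> 3 * 2 ^ k" using assms(1) by (induction k rule: dec_induct) auto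
  then have "real (8 * k) \<le> real (3 * 2 ^ k)" by (simp only: of_nat_le_iff)
  then have p: "8 * real k \<le> 3 * 2 ^ k" by simp
  have "1 \<le> 1 / (2 * real k) * (2 ^ k * (3 / 4))"
    using p k3 by (simp add: field_simps)
  also have "\<dots> \<le> 1 / (2 * real k) * (2 ^ k * (1 - h) ^ k)"
    using b k3 by (intro mult_left_mono) auto
  also have "2 ^ k * (1 - h) ^ k = (1 + s) ^ k"
    by (simp add: s_def h_def power_mult_distrib[symmetric] algebra_simps)
  finally show ?thesis by (simp add: s_def)
qed

lemma geometric_eventually_dominates:
  fixes a b A B :: real
  assumes "0 < b" "b < a" "0 < B"
  shows "\<exists>M. \<forall>m\<ge>M. A * b ^ m \<le> B * a ^ m"
proof -
  have r: "1 < a / b" using assms by simp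
  obtain M where M: "A / B < (a / b) ^ M" using real_arch_pow[OF r] by blast
  have "A * b ^ m \<le> B * a ^ m" if "M \<le> m" for m
  proof -
    have "(a / b) ^ M \<le> (a / b) ^ m" using r that by (intro power_increasing) auto
    then have "A / B \<le> a ^ m / b ^ m" using M by (simp add: power_divide)
    then show ?thesis using assms by (simp add: field_simps)
  qed
  then show ?thesis by blast
qed

lemma eventually_FO_le_FD:
  fixes j k :: nat
  assumes k: "3 \<le> k"
  shows "\<exists>N. \<forall>n\<ge>N. FO j k n \<le> FD j k n"
proof -
  define t s where "t = 1 - 1 / (2 * real k - 1)" and "s = 1 - 1 / (2 * real k)"
  define y where "y = (1 + t) * t ^ k - t"
  \<comment> \<open>The letters of the \<open>j\<close> prefixed blocks, plus the one extra letter
    in the lower bound for \<open>j = 0\<close>. The constant \<open>A\<close> absorbs the factor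
    \<open>(1 + t) ^ K\<close>.\<close>
  define K where "K = Suc (Suc k * j)"
  define A where "A = dvd_potential k t 1 False * (1 + t) ^ K / y ^ j"
  define B where "B = 1 - 1 / (1 + s) ^ k"
  have k3: "3 \<le> real k" using k by simp
  have t: "0 < t" "t < 1" and ts: "t < s" using k3 by (auto simp: t_def s_def field_simps)
  then have s: "0 < s" by simp
  have y: "0 < y" using upper_growth_rate[of k] k by (simp add: y_def t_def)
  have "1 < (1 + s) ^ k" using s k by (intro one_less_power) auto
  then have B: "0 < B" by (simp add: B_def)
  obtain M where M: "\<And>m. M \<le> m \<Longrightarrow> A * (1 + t) ^ m \<le> B * (1 + s) ^ m"
    using geometric_eventually_dominates[of "1 + t" "1 + s" B A] t ts B by auto
  have "FO j k n \<le> FD j k n" if n: "Suc (M + K) \<le> n" for n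
  proof -
    define m where "m = n - Suc K"
    have n_eq: "n = Suc (m + K)" and "M \<le> m" using n by (auto simp: m_def)
    have "y ^ j * real (FO j k n) \<le> dvd_potential k t 1 False * (1 + t) ^ (m + K)"
      unfolding n_eq FO_eq_dvd_count using t y k y_def by (intro dvd_count_upper_bound) auto
    then have "real (FO j k n) \<le> dvd_potential k t 1 False * (1 + t) ^ (m + K) / y ^ j"
      using y by (simp add: le_divide_eq mult.commute)
    also have "\<dots> = A * (1 + t) ^ m"
      by (simp add: A_def power_add mult_ac)
    also have "\<dots> \<le> B * (1 + s) ^ m" using M \<open>M \<le> m\<close> .
    also have "\<dots> \<le> real (FD j k n)"
      using rep_count_lower_bound[OF s lower_growth_rate[OF k, folded s_def], of m 1 j] k
      by (simp add: n_eq FD_eq_rep_count K_def B_def)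
    finally show ?thesis by simp
  qed
  then show ?thesis by blast
qed

theorem mainTheorem1:
  fixes j k :: nat
  assumes "k \<ge> 2"
  shows "\<exists>N. \<forall>n\<ge>N. FD j k n \<ge> FO j k n"
proof (cases "k = 2")
  case True
  have "FO j k n \<le> FD j k n" if "1 \<le> n" for n
    using that FD_2_eq_FO_2[of j "n - 1"] True by simp
  then show ?thesis by blast
next
  case False
  then show ?thesis using assms by (intro eventually_FO_le_FD) simp
qed

end
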